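(* Let $k\ge1$ be a fixed integer and let $\mathscr{F}$ be a family of graphs. (1) Suppose that for all sufficiently large $n$ the extremal graph for the spectral Turán problem forbidding $\mathscr{F}$ is $K_{k,n-k}$; that is, $K_{k,n-k}$ is $\mathscr{F}$-free and has the maximum spectral radius among all $\mathscr{F}$-free graphs on $n$ vertices. Then, for all sufficiently large $n$, $K_{k,n-k}$ is also an extremal graph for the corresponding forbidden subgraph problem in the $\ell_2$-norm; that is, $\mathrm{co}_2(K_{k,n-k})=\mathrm{exco}_2(n,\mathscr{F})$. (2) Suppose that for all sufficiently large $n$ the extremal graph for the spectral Turán problem forbidding $\mathscr{F}$ (an $\mathscr{F}$-free graph on $n$ vertices of maximum spectral radius) is $K_k\vee\overline{K_{n-k}}$ or $K_k\vee(\overline{K_{n-k-2}}\cup K_2)$. Then, as $n\to\infty$, $$\mathrm{exco}_2(n,\mathscr{F})=kn^2(1+o(1)).$$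
   Context: Graphs are finite and simple. For a graph $G$, $\mathrm{co}_2(G)=\sum_{v\in V(G)}d(v)^2$, the sum of squared degrees. A graph is $\mathscr{F}$-free if it contains no member of $\mathscr{F}$ as a (not necessarily induced) subgraph. $\mathrm{exco}_2(n,\mathscr{F})$ is the maximum of $\mathrm{co}_2(G)$ over all $\mathscr{F}$-free graphs $G$ on $n$ vertices. The spectral radius of $G$ is the largest eigenvalue of its adjacency matrix. $K_m$ is the complete graph on $m$ vertices, $\overline{G}$ is the complement of $G$, $\cup$ is disjoint union, $K_{k,n-k}$ is the complete bipartite graph, and $G\vee H$ is the join (the disjoint union of $G$ and $H$ with all edges between $V(G)$ and $V(H)$ added). *)

theory Defs
  imports
    "HOL-Library.Landau_Symbols"
    "Jordan_Normal_Form.Spectral_Radius"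
begin

datatype 'a graph = Graph (verts: "'a set") (edges: "'a set set")

definition simple_graph :: "'a graph \<Rightarrow> bool" where
  "simple_graph G \<longleftrightarrow>
     finite (verts G) \<and> (\<forall>e\<in>edges G. e \<subseteq> verts G \<and> card e = 2)"

definition vdegree :: "'a graph \<Rightarrow> 'a \<Rightarrow> nat" where
  "vdegree G v = card {e \<in> edges G. v \<in> e}"

definition co2 :: "'a graph \<Rightarrow> nat" where
  "co2 G = (\<Sum>v\<in>verts G. (vdegree G v)\<^sup>2)"

text \<open>Subgraphs need not be induced. The pattern \<open>H\<close> may live on a vertex type
  different from that of \<open>G\<close>.\<close>

definition contains_copy :: "'a graph \<Rightarrow> 'b graph \<Rightarrow> bool" where
  "contains_copy G H \<longleftrightarrow>
     (\<exists>f. inj_on f (verts H) \<and> f ` verts H \<subseteq> verts G \<and> (\<forall>e\<in>edges H. f ` e \<in> edges G))"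

definition family_free :: "'b graph set \<Rightarrow> 'a graph \<Rightarrow> bool" where
  "family_free \<F> G \<longleftrightarrow> (\<forall>H\<in>\<F>. \<not> contains_copy G H)"

text \<open>Since all notions below are invariant under isomorphism, the graphs on \<open>n\<close> vertices
  are represented by the labelled graphs with vertex set \<open>{0, \<dots>, n - 1}\<close>.\<close>

definition graph_on :: "nat \<Rightarrow> nat graph \<Rightarrow> bool" where
  "graph_on n G \<longleftrightarrow> simple_graph G \<and> verts G = {..<n}"

definition free_graphs :: "nat \<Rightarrow> 'b graph set \<Rightarrow> nat graph set" where
  "free_graphs n \<F> = {G. graph_on n G \<and> family_free \<F> G}"

text \<open>This is a maximum over a finite set; it is unspecified if there is no \<open>\<F>\<close>-free
  graph on \<open>n\<close> vertices.\<close>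

definition exco2 :: "nat \<Rightarrow> 'b graph set \<Rightarrow> nat" where
  "exco2 n \<F> = Max (co2 ` free_graphs n \<F>)"

text \<open>The adjacency matrix is meant for graphs with vertex set \<open>{0, \<dots>, n - 1}\<close>, whose
  vertices serve as row and column indices.\<close>

definition adj_matrix :: "nat graph \<Rightarrow> real mat" where
  "adj_matrix G =
     mat (card (verts G)) (card (verts G)) (\<lambda>(i, j). if {i, j} \<in> edges G then 1 else 0)"

definition graph_spectral_radius :: "nat graph \<Rightarrow> real" where
  "graph_spectral_radius G = Max (spectrum (adj_matrix G))"

definition spectral_extremal :: "nat \<Rightarrow> 'b graph set \<Rightarrow> nat graph \<Rightarrow> bool" where
  "spectral_extremal n \<F> G \<longleftrightarrow>
     G \<in> free_graphs n \<F> \<and>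
     (\<forall>G'\<in>free_graphs n \<F>. graph_spectral_radius G' \<le> graph_spectral_radius G)"

definition complete_graph :: "nat \<Rightarrow> nat graph" where
  "complete_graph m = Graph {..<m} {e. e \<subseteq> {..<m} \<and> card e = 2}"

definition complement_graph :: "'a graph \<Rightarrow> 'a graph" where
  "complement_graph G = Graph (verts G) ({e. e \<subseteq> verts G \<and> card e = 2} - edges G)"

definition complete_bipartite_graph :: "nat \<Rightarrow> nat \<Rightarrow> nat graph" where
  "complete_bipartite_graph a b =
     Graph {..<a + b} {{u, v} | u v. u < a \<and> a \<le> v \<and> v < a + b}"

text \<open>Disjoint union and join, for graphs with vertex sets \<open>{0, \<dots>, a - 1}\<close> and
  \<open>{0, \<dots>, b - 1}\<close>: the second graph is moved to \<open>{a, \<dots>, a + b - 1}\<close>.\<close>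

definition shift_graph :: "nat \<Rightarrow> nat graph \<Rightarrow> nat graph" where
  "shift_graph a H = Graph ((+) a ` verts H) ((`) ((+) a) ` edges H)"

definition disjoint_union_graph :: "nat graph \<Rightarrow> nat graph \<Rightarrow> nat graph" where
  "disjoint_union_graph G H =
     (let H' = shift_graph (card (verts G)) H
      in Graph (verts G \<union> verts H') (edges G \<union> edges H'))"

definition join_graph :: "nat graph \<Rightarrow> nat graph \<Rightarrow> nat graph" where
  "join_graph G H =
     (let H' = shift_graph (card (verts G)) H
      in Graph (verts G \<union> verts H')
           (edges G \<union> edges H' \<union> {{u, v} | u v. u \<in> verts G \<and> v \<in> verts H'}))"

end

theory Submission
  imports Defs "HOL-Analysis.Function_Topology" "HOL-Real_Asymp.Real_Asymp"
begin

text \<open>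
  Write \<open>\<rho>(G)\<close> for the spectral radius of a graph \<open>G\<close> on \<open>n\<close> vertices and \<open>A\<close> for its
  adjacency matrix. The row sums of \<open>A\<close> are the degrees, so \<open>co2 G\<close> is the squared Euclidean
  norm of \<open>A 1\<close>, where \<open>1\<close> is the all-ones vector of squared norm \<open>n\<close>. As \<open>A\<close> is symmetric
  with nonnegative entries, its operator norm is its largest eigenvalue, and therefore
  \<open>co2 G \<le> n \<rho>(G)\<^sup>2\<close>, which is \<open>co2_le_spectral\<close>. Any upper bound on the spectral radius of a spectrally extremal
  graph is thereby turned into an upper bound on \<open>exco2\<close>.

  For \<open>K\<^bsub>k,n-k\<^esub>\<close> one has \<open>\<rho>\<^sup>2 = k(n - k)\<close>, whereas \<open>co2 = k(n - k)n\<close>: the inequality is an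
  equality, so nothing can beat \<open>K\<^bsub>k,n-k\<^esub>\<close>. Both graphs of the second part have
  \<open>\<rho> \<le> sqrt (kn) + k\<close>, so \<open>exco2 \<le> n (sqrt (kn) + k)\<^sup>2 = kn\<^sup>2(1 + o(1))\<close>; and they are themselves
  free graphs with \<open>k\<close> vertices of degree \<open>n - 1\<close>, so \<open>exco2 \<ge> k(n - 1)\<^sup>2\<close>.

  The upper bounds on \<open>\<rho>\<close> need no exact eigenvalues: if \<open>A x \<le> c x\<close> holds entrywise for one
  positive vector \<open>x\<close>, then \<open>\<rho> \<le> c\<close> (\<open>spectral_radius_le_if_weights\<close>). In both parts a vector
  constant on the two sides of the partition suffices.
\<close>

section \<open>The largest eigenvalue of a symmetric matrix\<close>

text \<open>Vectors and matrices of size \<open>n\<close> are functions of which only the values at indices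
  below \<open>n\<close> matter. In this form the product topology provides compactness of the unit sphere
  for every \<open>n\<close>.\<close>

definition bilin :: "nat \<Rightarrow> (nat \<Rightarrow> nat \<Rightarrow> real) \<Rightarrow> (nat \<Rightarrow> real) \<Rightarrow> (nat \<Rightarrow> real) \<Rightarrow> real" where
  "bilin n a x y = (\<Sum>i<n. \<Sum>j<n. a i j * x i * y j)"

lemma bilin_sym:
  assumes "\<And>i j. a i j = a j i"
  shows "bilin n a x y = bilin n a y x"
proof -
  have "bilin n a x y = (\<Sum>j<n. \<Sum>i<n. a i j * x i * y j)"
    unfolding bilin_def by (rule sum.swap)
  also have "\<dots> = bilin n a y x"
    unfolding bilin_def
  proof (intro sum.cong refl)
    show "a i j * x i * y j = a j i * y j * x i" for i j
      using assms[of i j] by simp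
  qed
  finally show ?thesis .
qed

lemma bilin_add_scaled:
  assumes "\<And>i j. a i j = a j i"
  shows "bilin n a (\<lambda>i. x i + t * y i) (\<lambda>i. x i + t * y i)
    = bilin n a x x + 2 * t * bilin n a x y + t\<^sup>2 * bilin n a y y"
proof -
  have "a i j * (x i + t * y i) * (x j + t * y j)
    = a i j * x i * x j + t * (a i j * x i * y j) + t * (a i j * y i * x j)
      + t\<^sup>2 * (a i j * y i * y j)" for i j
    by (simp add: algebra_simps power2_eq_square)
  then have "bilin n a (\<lambda>i. x i + t * y i) (\<lambda>i. x i + t * y i)
    = bilin n a x x + t * bilin n a x y + t * bilin n a y x + t\<^sup>2 * bilin n a y y"
    unfolding bilin_def by (simp only: sum.distrib sum_distrib_left)
  then show ?thesis
    by (simp add: bilin_sym[of a n y x, OF assms])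
qed

lemma bilin_scale: "bilin n a (\<lambda>i. c * x i) (\<lambda>i. c * x i) = c\<^sup>2 * bilin n a x x"
  unfolding bilin_def by (simp add: sum_distrib_left power2_eq_square mult_ac)

lemma linear_coefficient_zero:
  fixes b c :: real
  assumes "\<And>t. t * b \<le> t\<^sup>2 * c"
  shows "b = 0"
proof -
  let ?d = "\<bar>c\<bar> + 1"
  have "b\<^sup>2 * ?d = ?d\<^sup>2 * (b / ?d * b)"
    by (simp add: field_simps power2_eq_square)
  also have "\<dots> \<le> ?d\<^sup>2 * ((b / ?d)\<^sup>2 * c)"
    by (intro mult_left_mono assms) simp
  also have "\<dots> = b\<^sup>2 * c"
    by (simp add: power_divide)
  also have "\<dots> \<le> b\<^sup>2 * \<bar>c\<bar>"
    by (intro mult_left_mono) auto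
  finally show ?thesis
    by (simp add: algebra_simps)
qed

lemma compact_unit_sphere:
  "compact {x :: nat \<Rightarrow> real. (\<forall>i\<ge>n. x i = 0) \<and> (\<Sum>i<n. (x i)\<^sup>2) = 1}" (is "compact ?S")
proof -
  let ?K = "PiE UNIV (\<lambda>i. if i < n then {-1..1 :: real} else {0})"
  have "compactin (product_topology (\<lambda>_. euclidean) UNIV) ?K"
    by (subst compactin_PiE) auto
  then have K: "compact ?K"
    by (simp add: euclidean_product_topology)
  have "continuous_on UNIV (\<lambda>x :: nat \<Rightarrow> real. \<Sum>i<n. (x i)\<^sup>2)"
    by (intro continuous_intros continuous_on_product_coordinates)
  then have "closed {x :: nat \<Rightarrow> real. (\<Sum>i<n. (x i)\<^sup>2) = 1}"
    by (intro closed_Collect_eq continuous_on_const)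
  then have "compact (?K \<inter> {x. (\<Sum>i<n. (x i)\<^sup>2) = 1})"
    using K by (rule compact_Int_closed[rotated])
  moreover have "x \<in> ?K" if "x \<in> ?S" for x
  proof -
    have "(x i)\<^sup>2 \<le> 1" if "i < n" for i
      using member_le_sum[of i "{..<n}" "\<lambda>i. (x i)\<^sup>2"] that \<open>x \<in> ?S\<close> by auto
    then have "\<bar>x i\<bar> \<le> 1" if "i < n" for i
      using that by (simp add: abs_square_le_1)
    with that show ?thesis
      by (auto simp: abs_le_iff)
  qed
  then have "?K \<inter> {x. (\<Sum>i<n. (x i)\<^sup>2) = 1} = ?S"
    by (auto simp: PiE_iff split: if_splits)
  ultimately show ?thesis
    by simp
qed

text \<open>The quadratic form attains a maximum \<open>\<mu>\<close> on the unit sphere. At a maximiser \<open>x\<close> the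
  function \<open>t \<mapsto> \<mu> \<bar>x + t y\<bar>\<^sup>2 - \<langle>A (x + t y), x + t y\<rangle>\<close> has a minimum at \<open>t = 0\<close> for every
  direction \<open>y\<close>; the vanishing of its linear coefficient along the coordinate directions says
  that \<open>A x = \<mu> x\<close>.\<close>

lemma max_quadratic_form_eigenvalue:
  fixes a :: "nat \<Rightarrow> nat \<Rightarrow> real"
  assumes "n > 0" and sym: "\<And>i j. a i j = a j i"
  obtains x \<mu> where "(\<Sum>i<n. (x i)\<^sup>2) = 1"
    and "\<And>i. i < n \<Longrightarrow> (\<Sum>j<n. a i j * x j) = \<mu> * x i"
    and "\<And>y. bilin n a y y \<le> \<mu> * (\<Sum>i<n. (y i)\<^sup>2)"
proof -
  define S where "S = {x :: nat \<Rightarrow> real. (\<forall>i\<ge>n. x i = 0) \<and> (\<Sum>i<n. (x i)\<^sup>2) = 1}"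
  have "(if i = 0 then 1 else 0 :: real)\<^sup>2 = (if i = 0 then 1 else 0)" for i :: nat
    by simp
  then have "(\<lambda>i. if i = 0 then 1 else 0) \<in> S"
    using \<open>n > 0\<close> by (simp add: S_def)
  then have "S \<noteq> {}" by blast
  have coord: "continuous_on S (\<lambda>x. x i)" for i
    by (rule continuous_on_subset[OF continuous_on_product_coordinates subset_UNIV])
  have "continuous_on S (\<lambda>x. bilin n a x x)"
    unfolding bilin_def by (intro continuous_on_sum continuous_on_mult continuous_on_const coord)
  from continuous_attains_sup[OF compact_unit_sphere[of n, folded S_def] \<open>S \<noteq> {}\<close> this]
  obtain x where x: "x \<in> S" and max: "\<And>y. y \<in> S \<Longrightarrow> bilin n a y y \<le> bilin n a x x"
    by blast
  define \<mu> where "\<mu> = bilin n a x x"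
  have bound: "bilin n a y y \<le> \<mu> * (\<Sum>i<n. (y i)\<^sup>2)" for y
  proof (cases "(\<Sum>i<n. (y i)\<^sup>2) = 0")
    case True
    then have "\<forall>i<n. y i = 0"
      by (subst (asm) sum_nonneg_eq_0_iff) auto
    with True show ?thesis by (simp add: bilin_def)
  next
    case False
    define s where "s = (\<Sum>i<n. (y i)\<^sup>2)"
    have "s > 0"
      using False sum_nonneg[of "{..<n}" "\<lambda>i. (y i)\<^sup>2"] unfolding s_def by auto
    define z where "z = (\<lambda>i. if i < n then 1 / sqrt s * y i else 0)"
    have "(\<Sum>i<n. (z i)\<^sup>2) = (\<Sum>i<n. (y i)\<^sup>2) / s"
      using \<open>s > 0\<close> by (simp add: z_def power_divide sum_divide_distrib)
    then have "z \<in> S"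
      using \<open>s > 0\<close> by (simp add: S_def z_def s_def)
    have "bilin n a z z = bilin n a (\<lambda>i. 1 / sqrt s * y i) (\<lambda>i. 1 / sqrt s * y i)"
      unfolding bilin_def z_def by (intro sum.cong) auto
    also have "\<dots> = bilin n a y y / s"
      using \<open>s > 0\<close> unfolding bilin_scale by (simp add: power_divide)
    finally have "bilin n a y y / s \<le> \<mu>"
      using max[OF \<open>z \<in> S\<close>] by (simp add: \<mu>_def)
    with \<open>s > 0\<close> show ?thesis
      by (simp add: pos_divide_le_eq flip: s_def)
  qed
  have "(\<Sum>j<n. a i j * x j) = \<mu> * x i" if "i < n" for i
  proof -
    define e :: "nat \<Rightarrow> real" where "e = (\<lambda>j. if j = i then 1 else 0)"
    have pick: "z * e j = (if j = i then z else 0)" "(e j)\<^sup>2 = (if j = i then 1 else 0)" for z j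
      by (simp_all add: e_def)
    have e: "(\<Sum>j<n. x j * e j) = x i" "(\<Sum>j<n. (e j)\<^sup>2) = 1"
      using that by (simp_all add: pick)
    have "bilin n a x e = (\<Sum>k<n. a k i * x k)"
      using that by (simp add: bilin_def pick)
    also have "\<dots> = (\<Sum>j<n. a i j * x j)"
      by (simp only: sym[of _ i])
    finally have axe: "bilin n a x e = (\<Sum>j<n. a i j * x j)" .
    have aee: "bilin n a e e = a i i"
      using that by (simp add: bilin_def pick)
    have "t * (2 * ((\<Sum>j<n. a i j * x j) - \<mu> * x i)) \<le> t\<^sup>2 * (\<mu> - a i i)" for t
    proof -
      have "(\<Sum>j<n. (x j + t * e j)\<^sup>2)
          = (\<Sum>j<n. (x j)\<^sup>2) + 2 * t * (\<Sum>j<n. x j * e j) + t\<^sup>2 * (\<Sum>j<n. (e j)\<^sup>2)"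
        by (simp add: sum_distrib_left sum.distrib algebra_simps power2_eq_square)
      then have "(\<Sum>j<n. (x j + t * e j)\<^sup>2) = 1 + 2 * t * x i + t\<^sup>2"
        using x e by (simp add: S_def)
      with bound[of "\<lambda>j. x j + t * e j"] show ?thesis
        unfolding bilin_add_scaled[of a, OF sym] by (simp add: axe aee flip: \<mu>_def) (simp add: algebra_simps)
    qed
    from linear_coefficient_zero[OF this] show ?thesis by simp
  qed
  moreover have "(\<Sum>i<n. (x i)\<^sup>2) = 1"
    using x by (simp add: S_def)
  ultimately show ?thesis using that bound by blast
qed

text \<open>Replacing a vector by its absolute values does not decrease the form, so \<open>\<mu>\<close> bounds the
  form from both sides. Polarisation of \<open>\<langle>A 1, y\<rangle>\<close> at \<open>y = A 1\<close> then bounds the norm of \<open>A 1\<close>;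
  the argument is the usual one for the operator norm of a symmetric matrix.\<close>

lemma sum_row_sums_squared_le:
  fixes a :: "nat \<Rightarrow> nat \<Rightarrow> real"
  assumes sym: "\<And>i j. a i j = a j i" and nonneg: "\<And>i j. 0 \<le> a i j"
    and bound: "\<And>y. bilin n a y y \<le> \<mu> * (\<Sum>i<n. (y i)\<^sup>2)"
    and "0 \<le> \<mu>"
  shows "(\<Sum>i<n. (\<Sum>j<n. a i j)\<^sup>2) \<le> n * \<mu>\<^sup>2"
proof -
  define u where "u = (\<lambda>i. \<Sum>j<n. a i j)"
  define S where "S = (\<Sum>i<n. (u i)\<^sup>2)"
  have lower: "- bilin n a y y \<le> \<mu> * (\<Sum>i<n. (y i)\<^sup>2)" for y
  proof -
    have "- (a i j * y i * y j) \<le> a i j * \<bar>y i\<bar> * \<bar>y j\<bar>" for i j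
      using nonneg[of i j] abs_ge_minus_self[of "a i j * y i * y j"] by (simp add: abs_mult)
    then have "- bilin n a y y \<le> bilin n a (\<lambda>i. \<bar>y i\<bar>) (\<lambda>i. \<bar>y i\<bar>)"
      unfolding bilin_def by (simp add: sum_mono flip: sum_negf)
    with bound[of "\<lambda>i. \<bar>y i\<bar>"] show ?thesis by simp
  qed
  have "bilin n a u (\<lambda>_. 1) = S"
    by (simp add: bilin_def S_def u_def power2_eq_square sum_distrib_left sum_distrib_right mult_ac)
  then have uS: "bilin n a (\<lambda>_. 1) u = S"
    using bilin_sym[of a n "\<lambda>_. 1" u, OF sym] by simp
  have norm: "(\<Sum>i<n. (1 + t * u i)\<^sup>2) = n + 2 * t * (\<Sum>i<n. u i) + t\<^sup>2 * S" for t
    by (simp add: S_def sum_distrib_left algebra_simps power2_eq_square sum.distrib)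
  have key: "2 * t * S \<le> \<mu> * (n + t\<^sup>2 * S)" for t
    using bound[of "\<lambda>i. 1 + t * u i"] lower[of "\<lambda>i. 1 + (- t) * u i"]
    unfolding bilin_add_scaled[of a, OF sym] norm uS by (simp add: algebra_simps)
  have "S \<le> n * \<mu>\<^sup>2"
  proof (cases "\<mu> = 0")
    case True
    with key[of 1] show ?thesis by simp
  next
    case False
    then have "\<mu> > 0" using \<open>0 \<le> \<mu>\<close> by simp
    \<comment> \<open>The best choice is \<open>t = sqrt (n / S)\<close>, which equals \<open>1 / \<mu>\<close> in the case of equality.\<close>
    have "2 * S = \<mu> * (2 * (1 / \<mu>) * S)"
      using \<open>\<mu> > 0\<close> by simp
    also have "\<dots> \<le> \<mu> * (\<mu> * (n + (1 / \<mu>)\<^sup>2 * S))"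
      using key[of "1 / \<mu>"] \<open>\<mu> > 0\<close> by (intro mult_left_mono) auto
    also have "\<dots> = n * \<mu>\<^sup>2 + S"
      using \<open>\<mu> > 0\<close> by (simp add: field_simps power2_eq_square)
    finally show ?thesis by simp
  qed
  then show ?thesis by (simp add: S_def u_def)
qed

section \<open>Degrees and the spectral radius\<close>

definition adj :: "'a graph \<Rightarrow> 'a \<Rightarrow> 'a \<Rightarrow> real" where
  "adj G u v = (if {u, v} \<in> edges G then 1 else 0)"

lemma adj_commute: "adj G u v = adj G v u"
  by (simp add: adj_def insert_commute)

lemma graph_on_edge_distinct:
  assumes "graph_on n G" "{u, v} \<in> edges G"
  shows "u \<noteq> v" "u < n" "v < n"
  using assms by (auto simp: graph_on_def simple_graph_def)

lemma vdegree_eq_card_neighbours: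
  assumes G: "graph_on n G"
  shows "vdegree G v = card {w. w < n \<and> {v, w} \<in> edges G}"
proof -
  have "{e \<in> edges G. v \<in> e} = (\<lambda>w. {v, w}) ` {w. w < n \<and> {v, w} \<in> edges G}"
  proof (intro equalityI subsetI)
    fix e assume e: "e \<in> {e \<in> edges G. v \<in> e}"
    then have "card e = 2"
      using G by (auto simp: graph_on_def simple_graph_def)
    with e obtain w where "e = {v, w}"
      by (auto simp: card_2_iff)
    with e graph_on_edge_distinct[OF G] show "e \<in> (\<lambda>w. {v, w}) ` {w. w < n \<and> {v, w} \<in> edges G}"
      by auto
  qed auto
  moreover have "inj_on (\<lambda>w. {v, w}) {w. w < n \<and> {v, w} \<in> edges G}"
    by (auto simp: inj_on_def doubleton_eq_iff)
  ultimately show ?thesis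
    by (simp add: vdegree_def card_image)
qed

lemma vdegree_eq_sum_adj:
  assumes "graph_on n G"
  shows "real (vdegree G v) = (\<Sum>w<n. adj G v w)"
proof -
  have "(\<Sum>w<n. adj G v w) = real (card ({..<n} \<inter> {w. {v, w} \<in> edges G}))"
    by (simp add: adj_def sum.If_cases)
  also have "{..<n} \<inter> {w. {v, w} \<in> edges G} = {w. w < n \<and> {v, w} \<in> edges G}"
    by auto
  finally show ?thesis
    by (simp add: vdegree_eq_card_neighbours[OF assms])
qed

lemma adj_matrix_carrier: "graph_on n G \<Longrightarrow> adj_matrix G \<in> carrier_mat n n"
  by (simp add: adj_matrix_def graph_on_def)

lemma spectrum_adj_matrix_iff:
  assumes G: "graph_on n G"
  shows "\<mu> \<in> spectrum (adj_matrix G) \<longleftrightarrow>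
    (\<exists>x. (\<exists>i<n. x i \<noteq> 0) \<and> (\<forall>i<n. (\<Sum>j<n. adj G i j * x j) = \<mu> * x i))"
proof -
  have entry: "adj_matrix G = mat n n (\<lambda>(i, j). adj G i j)"
    using G by (simp add: adj_matrix_def adj_def graph_on_def)
  have mult: "(adj_matrix G *\<^sub>v v = \<mu> \<cdot>\<^sub>v v) \<longleftrightarrow>
      (\<forall>i<n. (\<Sum>j<n. adj G i j * vec_index v j) = \<mu> * vec_index v i)" if "v \<in> carrier_vec n" for v
    using that unfolding entry vec_eq_iff
    by (simp add: scalar_prod_def lessThan_atLeast0)
  have nonzero: "v \<noteq> 0\<^sub>v n \<longleftrightarrow> (\<exists>i<n. vec_index v i \<noteq> 0)" if "v \<in> carrier_vec n" for v :: "real vec"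
    using that by (auto simp: vec_eq_iff)
  have "dim_row (adj_matrix G) = n"
    using adj_matrix_carrier[OF G] by auto
  then have "\<mu> \<in> spectrum (adj_matrix G) \<longleftrightarrow>
      (\<exists>v\<in>carrier_vec n. (\<exists>i<n. vec_index v i \<noteq> 0) \<and>
        (\<forall>i<n. (\<Sum>j<n. adj G i j * vec_index v j) = \<mu> * vec_index v i))"
    unfolding spectrum_def eigenvalue_def eigenvector_def using mult nonzero by auto
  also have "\<dots> \<longleftrightarrow> (\<exists>x. (\<exists>i<n. x i \<noteq> 0) \<and> (\<forall>i<n. (\<Sum>j<n. adj G i j * x j) = \<mu> * x i))"
  proof
    assume "\<exists>x. (\<exists>i<n. x i \<noteq> 0) \<and> (\<forall>i<n. (\<Sum>j<n. adj G i j * x j) = \<mu> * x i)"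
    then obtain x where "(\<exists>i<n. x i \<noteq> 0) \<and> (\<forall>i<n. (\<Sum>j<n. adj G i j * x j) = \<mu> * x i)" by blast
    then show "\<exists>v\<in>carrier_vec n. (\<exists>i<n. vec_index v i \<noteq> 0) \<and>
        (\<forall>i<n. (\<Sum>j<n. adj G i j * vec_index v j) = \<mu> * vec_index v i)"
      by (intro bexI[of _ "vec n x"]) auto
  qed blast
  finally show ?thesis .
qed

text \<open>A real matrix need not have a real eigenvalue. The eigenvalue found here also shows that
  the maximum defining the spectral radius of a graph is taken over a nonempty set.\<close>

lemma spectral_radius_dominates_quadratic_form:
  assumes G: "graph_on n G" and "n > 0"
  obtains \<mu> where "\<mu> \<in> spectrum (adj_matrix G)" "0 \<le> \<mu>" "\<mu> \<le> graph_spectral_radius G"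
    "\<And>y. bilin n (adj G) y y \<le> \<mu> * (\<Sum>i<n. (y i)\<^sup>2)"
proof -
  obtain x \<mu> where x: "(\<Sum>i<n. (x i)\<^sup>2) = 1"
    and eig: "\<And>i. i < n \<Longrightarrow> (\<Sum>j<n. adj G i j * x j) = \<mu> * x i"
    and bound: "\<And>y. bilin n (adj G) y y \<le> \<mu> * (\<Sum>i<n. (y i)\<^sup>2)"
    by (rule max_quadratic_form_eigenvalue[of n "adj G", OF \<open>n > 0\<close> adj_commute]) blast
  have "\<exists>i<n. x i \<noteq> 0"
  proof (rule ccontr)
    assume "\<not> (\<exists>i<n. x i \<noteq> 0)"
    then have "(\<Sum>i<n. (x i)\<^sup>2) = 0" by simp
    with x show False by simp
  qed
  with eig have spec: "\<mu> \<in> spectrum (adj_matrix G)"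
    unfolding spectrum_adj_matrix_iff[OF G] by blast
  have "0 \<le> bilin n (adj G) (\<lambda>_. 1) (\<lambda>_. 1)"
    unfolding bilin_def adj_def by (intro sum_nonneg) auto
  also have "\<dots> \<le> \<mu> * n"
    using bound[of "\<lambda>_. 1"] by simp
  finally have "0 \<le> \<mu>"
    using \<open>n > 0\<close> by (simp add: zero_le_mult_iff)
  moreover have "\<mu> \<le> graph_spectral_radius G"
    unfolding graph_spectral_radius_def
    using spec card_finite_spectrum(1)[OF adj_matrix_carrier[OF G]] by simp
  ultimately show ?thesis using that spec bound by blast
qed

lemma spectral_radius_nonneg:
  assumes "graph_on n G" "n > 0"
  shows "0 \<le> graph_spectral_radius G"
  by (rule spectral_radius_dominates_quadratic_form[OF assms]) linarith

lemma co2_le_spectral: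
  assumes G: "graph_on n G" and "n > 0"
  shows "real (co2 G) \<le> n * (graph_spectral_radius G)\<^sup>2"
proof -
  obtain \<mu> where \<mu>: "0 \<le> \<mu>" "\<mu> \<le> graph_spectral_radius G"
    "\<And>y. bilin n (adj G) y y \<le> \<mu> * (\<Sum>i<n. (y i)\<^sup>2)"
    by (rule spectral_radius_dominates_quadratic_form[OF assms]) blast
  have "real (co2 G) = (\<Sum>v<n. (\<Sum>w<n. adj G v w)\<^sup>2)"
    using G by (simp add: co2_def graph_on_def flip: vdegree_eq_sum_adj[OF G])
  also have "\<dots> \<le> n * \<mu>\<^sup>2"
    using sum_row_sums_squared_le[of "adj G" n \<mu>, OF adj_commute _ \<mu>(3) \<mu>(1)] by (simp add: adj_def)
  also have "\<dots> \<le> n * (graph_spectral_radius G)\<^sup>2"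
    using \<mu> by (intro mult_left_mono power_mono) auto
  finally show ?thesis .
qed

text \<open>Let \<open>v\<close> be an eigenvector for \<open>\<lambda>\<close>. At an index \<open>i\<close> where \<open>\<bar>v i\<bar> / x i\<close> is largest, the
  eigenvalue equation gives
  \<open>\<lambda> \<bar>v i\<bar> \<le> (\<Sum>j. A i j * \<bar>v j\<bar>) \<le> (\<bar>v i\<bar> / x i) * (\<Sum>j. A i j * x j) \<le> c \<bar>v i\<bar>\<close>.\<close>

lemma spectral_radius_le_if_weights:
  assumes G: "graph_on n G" and "n > 0"
    and pos: "\<And>i. i < n \<Longrightarrow> 0 < x i"
    and weights: "\<And>i. i < n \<Longrightarrow> (\<Sum>j<n. adj G i j * x j) \<le> c * x i"
  shows "graph_spectral_radius G \<le> c"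
proof -
  have "\<mu> \<le> c" if "\<mu> \<in> spectrum (adj_matrix G)" for \<mu>
  proof -
    obtain v where "\<exists>i<n. v i \<noteq> 0" and eig: "\<And>i. i < n \<Longrightarrow> (\<Sum>j<n. adj G i j * v j) = \<mu> * v i"
      using \<open>\<mu> \<in> _\<close> unfolding spectrum_adj_matrix_iff[OF G] by blast
    define M where "M = Max ((\<lambda>i. \<bar>v i\<bar> / x i) ` {..<n})"
    have ne: "(\<lambda>i. \<bar>v i\<bar> / x i) ` {..<n} \<noteq> {}"
      using \<open>n > 0\<close> by blast
    have M: "\<bar>v j\<bar> \<le> M * x j" if "j < n" for j
    proof -
      have "\<bar>v j\<bar> / x j \<le> M"
        unfolding M_def using that by (intro Max_ge) auto
      then show ?thesis
        using pos[OF that] by (simp add: pos_divide_le_eq)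
    qed
    obtain i where i: "i < n" "M = \<bar>v i\<bar> / x i"
      using Max_in[OF _ ne] unfolding M_def by auto
    have "M > 0"
    proof -
      obtain j where j: "j < n" "v j \<noteq> 0" using \<open>\<exists>i<n. v i \<noteq> 0\<close> by blast
      then have "0 < M * x j" using M[of j] by auto
      with pos[OF j(1)] show ?thesis by (simp add: zero_less_mult_iff)
    qed
    have vi: "\<bar>v i\<bar> = M * x i" "0 < M * x i"
      using i pos[OF i(1)] \<open>M > 0\<close> by auto
    have "\<mu> * (M * x i) \<le> \<bar>\<mu> * v i\<bar>"
      using mult_right_mono[OF abs_ge_self[of \<mu>], of "\<bar>v i\<bar>"] by (simp add: abs_mult flip: vi(1))
    also have "\<dots> = \<bar>\<Sum>j<n. adj G i j * v j\<bar>"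
      using eig[OF i(1)] by simp
    also have "\<dots> \<le> (\<Sum>j<n. adj G i j * (M * x j))"
      using M by (intro order_trans[OF sum_abs] sum_mono) (auto simp: adj_def)
    also have "\<dots> = M * (\<Sum>j<n. adj G i j * x j)"
      by (simp add: sum_distrib_left mult_ac)
    also have "\<dots> \<le> M * (c * x i)"
      using weights[OF i(1)] \<open>M > 0\<close> by (intro mult_left_mono) auto
    also have "\<dots> = c * (M * x i)" by simp
    finally show ?thesis
      using vi(2) by (rule mult_right_le_imp_le)
  qed
  moreover have "finite (spectrum (adj_matrix G))"
    using card_finite_spectrum(1)[OF adj_matrix_carrier[OF G]] .
  moreover have "spectrum (adj_matrix G) \<noteq> {}"
    by (rule spectral_radius_dominates_quadratic_form[OF G \<open>n > 0\<close>]) blast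
  ultimately show ?thesis
    unfolding graph_spectral_radius_def by simp
qed

section \<open>From the spectral to the degree problem\<close>

lemma finite_free_graphs: "finite (free_graphs n \<F>)"
proof (rule finite_subset)
  show "free_graphs n \<F> \<subseteq> Graph {..<n} ` Pow (Pow {..<n})"
  proof
    fix G assume "G \<in> free_graphs n \<F>"
    then have "verts G = {..<n}" "edges G \<subseteq> Pow {..<n}"
      by (auto simp: free_graphs_def graph_on_def simple_graph_def)
    then show "G \<in> Graph {..<n} ` Pow (Pow {..<n})"
      by (cases G) auto
  qed
qed simp

lemma co2_le_exco2: "G \<in> free_graphs n \<F> \<Longrightarrow> co2 G \<le> exco2 n \<F>"
  unfolding exco2_def using finite_free_graphs by (intro Max_ge) auto

lemma exco2_le_spectral:
  assumes ext: "spectral_extremal n \<F> G" and "n > 0"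
  shows "real (exco2 n \<F>) \<le> n * (graph_spectral_radius G)\<^sup>2"
proof -
  have "co2 ` free_graphs n \<F> \<noteq> {}"
    using ext by (auto simp: spectral_extremal_def)
  then have "exco2 n \<F> \<in> co2 ` free_graphs n \<F>"
    unfolding exco2_def using finite_free_graphs by (intro Max_in) auto
  then obtain H where H: "H \<in> free_graphs n \<F>" "exco2 n \<F> = co2 H" by blast
  then have on: "graph_on n H" by (simp add: free_graphs_def)
  have "real (co2 H) \<le> n * (graph_spectral_radius H)\<^sup>2"
    using co2_le_spectral[OF on \<open>n > 0\<close>] .
  also have "\<dots> \<le> n * (graph_spectral_radius G)\<^sup>2"
    using ext H(1) spectral_radius_nonneg[OF on \<open>n > 0\<close>]
    by (intro mult_left_mono power_mono) (auto simp: spectral_extremal_def)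
  finally show ?thesis using H(2) by simp
qed

lemma sum_split_at:
  fixes f :: "nat \<Rightarrow> 'a :: comm_monoid_add"
  assumes "k \<le> n"
  shows "(\<Sum>j<n. f j) = (\<Sum>j<k. f j) + (\<Sum>j\<in>{k..<n}. f j)"
  using assms sum.atLeastLessThan_concat[of 0 k n f] by (simp add: lessThan_atLeast0)

section \<open>Complete bipartite graphs\<close>

lemma graph_on_complete_bipartite: "graph_on (a + b) (complete_bipartite_graph a b)"
  by (auto simp: graph_on_def simple_graph_def complete_bipartite_graph_def card_insert_if)

lemma adj_complete_bipartite:
  assumes "i < a + b" "j < a + b"
  shows "adj (complete_bipartite_graph a b) i j = (if (i < a) = (j < a) then 0 else 1)"
proof -
  have "{i, j} \<in> edges (complete_bipartite_graph a b) \<longleftrightarrow>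
      (i < a \<and> a \<le> j) \<or> (j < a \<and> a \<le> i)"
    using assms unfolding complete_bipartite_graph_def by (auto simp: doubleton_eq_iff)
  then show ?thesis
    by (auto simp: adj_def)
qed

lemma row_sum_complete_bipartite:
  assumes "i < a + b"
  shows "(\<Sum>j<a + b. adj (complete_bipartite_graph a b) i j * (if j < a then x else y))
    = (if i < a then b * y else a * x)"
proof -
  have "(\<Sum>j<a. adj (complete_bipartite_graph a b) i j * (if j < a then x else y))
      = (\<Sum>j<a. if i < a then 0 else x)"
    using assms by (intro sum.cong) (auto simp: adj_complete_bipartite)
  moreover have "(\<Sum>j\<in>{a..<a + b}. adj (complete_bipartite_graph a b) i j * (if j < a then x else y))
      = (\<Sum>j\<in>{a..<a + b}. if i < a then y else 0)"
    using assms by (intro sum.cong) (auto simp: adj_complete_bipartite)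
  ultimately show ?thesis
    by (simp add: sum_split_at[of a "a + b"])
qed

lemma co2_complete_bipartite: "co2 (complete_bipartite_graph a b) = a * b * (a + b)"
proof -
  let ?K = "complete_bipartite_graph a b"
  have "vdegree ?K v = (if v < a then b else a)" if "v < a + b" for v
  proof -
    have "real (vdegree ?K v) = real (if v < a then b else a)"
      using row_sum_complete_bipartite[OF that, of 1 1]
      by (simp add: vdegree_eq_sum_adj[OF graph_on_complete_bipartite])
    then show ?thesis
      by (simp only: of_nat_eq_iff)
  qed
  then have "co2 ?K = (\<Sum>v<a + b. (if v < a then b else a)\<^sup>2)"
    unfolding co2_def by (intro sum.cong) (auto simp: complete_bipartite_graph_def)
  also have "\<dots> = a * b\<^sup>2 + b * a\<^sup>2"
    by (simp add: sum_split_at[of a "a + b"])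
  finally show ?thesis
    by (simp add: algebra_simps power2_eq_square)
qed

lemma spectral_radius_complete_bipartite_le:
  assumes "a > 0" "b > 0"
  shows "graph_spectral_radius (complete_bipartite_graph a b) \<le> sqrt (a * b)"
proof (rule spectral_radius_le_if_weights[OF graph_on_complete_bipartite])
  \<comment> \<open>The eigenvector of \<open>sqrt (a * b)\<close>.\<close>
  let ?x = "\<lambda>i. if i < a then sqrt b else sqrt a"
  show "0 < ?x i" for i using assms by simp
  have "sqrt a * sqrt b * sqrt a = (sqrt a)\<^sup>2 * sqrt b"
    by (simp only: power2_eq_square mult_ac)
  then have sq: "sqrt a * sqrt b * sqrt a = a * sqrt b"
    by simp
  show "(\<Sum>j<a + b. adj (complete_bipartite_graph a b) i j * ?x j) \<le> sqrt (a * b) * ?x i"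
    if "i < a + b" for i
    unfolding row_sum_complete_bipartite[OF that] by (simp add: real_sqrt_mult sq)
qed (use assms in simp)

section \<open>Joins with a clique\<close>

text \<open>Common to the two graphs of the second part: every vertex below \<open>k\<close> is adjacent to all
  others, and every other vertex has at most one neighbour outside the clique.\<close>

definition near_clique_join :: "nat \<Rightarrow> nat \<Rightarrow> nat graph \<Rightarrow> bool" where
  "near_clique_join k n G \<longleftrightarrow> graph_on n G \<and>
     (\<forall>i<k. \<forall>j<n. i \<noteq> j \<longrightarrow> {i, j} \<in> edges G) \<and>
     (\<forall>i<n. k \<le> i \<longrightarrow> card {j \<in> {k..<n}. {i, j} \<in> edges G} \<le> 1)"

lemma co2_near_clique_join_ge:
  assumes G: "near_clique_join k n G" and "k \<le> n"
  shows "k * (n - 1)\<^sup>2 \<le> co2 G"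
proof -
  have on: "graph_on n G" using G by (simp add: near_clique_join_def)
  have "vdegree G v = n - 1" if "v < k" for v
  proof -
    have "{w. w < n \<and> {v, w} \<in> edges G} = {..<n} - {v}"
      using G that graph_on_edge_distinct[OF on, of v v] by (auto simp: near_clique_join_def)
    then show ?thesis
      using that \<open>k \<le> n\<close> by (simp add: vdegree_eq_card_neighbours[OF on])
  qed
  then have "k * (n - 1)\<^sup>2 = (\<Sum>v<k. (vdegree G v)\<^sup>2)"
    by simp
  also have "\<dots> \<le> (\<Sum>v<n. (vdegree G v)\<^sup>2)"
    using \<open>k \<le> n\<close> by (intro sum_mono2) auto
  finally show ?thesis
    using on by (simp add: co2_def graph_on_def)
qed

lemma spectral_radius_near_clique_join_le:
  assumes G: "near_clique_join k n G" and "k \<ge> 1" "k \<le> n"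
  shows "graph_spectral_radius G \<le> sqrt (k * n) + k"
proof (rule spectral_radius_le_if_weights)
  show on: "graph_on n G" using G by (simp add: near_clique_join_def)
  show "n > 0" using assms by simp
  \<comment> \<open>Nearly the eigenvector of the complete bipartite graph between the two sides; the edges
    inside the sides contribute at most \<open>k\<close>.\<close>
  let ?x = "\<lambda>i. if i < k then sqrt n else sqrt k"
  show "0 < ?x i" if "i < n" for i using assms by simp
  show "(\<Sum>j<n. adj G i j * ?x j) \<le> (sqrt (k * n) + k) * ?x i" if "i < n" for i
  proof -
    have "(\<Sum>j<n. adj G i j * ?x j)
        = (\<Sum>j<k. adj G i j) * sqrt n + (\<Sum>j\<in>{k..<n}. adj G i j) * sqrt k"
      by (simp add: sum_split_at[OF \<open>k \<le> n\<close>] sum_distrib_right)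
    also have "\<dots> \<le> k * sqrt n + (\<Sum>j\<in>{k..<n}. adj G i j) * sqrt k"
      using sum_bounded_above[of "{..<k}" "adj G i" 1]
      by (intro add_right_mono mult_right_mono) (auto simp: adj_def)
    also have "\<dots> \<le> (sqrt (k * n) + k) * ?x i"
    proof (cases "i < k")
      case True
      have "(\<Sum>j\<in>{k..<n}. adj G i j) \<le> n"
        using sum_bounded_above[of "{k..<n}" "adj G i" 1] by (force simp: adj_def)
      then have "(\<Sum>j\<in>{k..<n}. adj G i j) * sqrt k \<le> n * sqrt k"
        by (intro mult_right_mono) auto
      moreover have "(sqrt (k * n) + k) * sqrt n = k * sqrt n + n * sqrt k"
        by (simp add: real_sqrt_mult algebra_simps)
      ultimately show ?thesis using True by simp
    next
      case False
      have "(\<Sum>j\<in>{k..<n}. adj G i j) = card ({k..<n} \<inter> {j. {i, j} \<in> edges G})"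
        by (simp add: adj_def sum.If_cases)
      also have "{k..<n} \<inter> {j. {i, j} \<in> edges G} = {j \<in> {k..<n}. {i, j} \<in> edges G}"
        by auto
      finally have "(\<Sum>j\<in>{k..<n}. adj G i j) \<le> k"
        using G False \<open>i < n\<close> \<open>k \<ge> 1\<close> by (simp add: near_clique_join_def) (meson not_less order_trans)
      then have "(\<Sum>j\<in>{k..<n}. adj G i j) * sqrt k \<le> k * sqrt k"
        by (intro mult_right_mono) auto
      moreover have "(sqrt (k * n) + k) * sqrt k = k * sqrt n + k * sqrt k"
        by (simp add: real_sqrt_mult algebra_simps)
      ultimately show ?thesis using False by simp
    qed
    finally show ?thesis .
  qed
qed

lemma edges_join_complete:
  "edges (join_graph (complete_graph k) H) = {e. e \<subseteq> {..<k} \<and> card e = 2} \<union>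
     (`) ((+) k) ` edges H \<union> {{u, v} | u v. u < k \<and> v \<in> (+) k ` verts H}"
  by (simp add: join_graph_def complete_graph_def shift_graph_def Let_def)

lemma near_clique_join_join_graph:
  assumes on: "graph_on n (join_graph (complete_graph k) H)"
    and H: "verts H = {..<m}" "n = k + m"
    and few: "\<And>i. card {j. {i, j} \<in> edges H} \<le> 1" "\<And>i. finite {j. {i, j} \<in> edges H}"
  shows "near_clique_join k n (join_graph (complete_graph k) H)"
  unfolding near_clique_join_def
proof (intro conjI allI impI on)
  have shifted: "(+) k ` verts H = {k..<n}"
    using H by (simp add: lessThan_atLeast0 add.commute)
  fix i j assume "i < k" "j < n" "i \<noteq> j"
  then show "{i, j} \<in> edges (join_graph (complete_graph k) H)"
    unfolding edges_join_complete shifted by (cases "j < k") fastforce+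
next
  fix i assume "i < n" "k \<le> i"
  have "{j \<in> {k..<n}. {i, j} \<in> edges (join_graph (complete_graph k) H)}
      \<subseteq> (+) k ` {j. {i - k, j} \<in> edges H}"
  proof
    fix j assume j: "j \<in> {j \<in> {k..<n}. {i, j} \<in> edges (join_graph (complete_graph k) H)}"
    have "\<not> {i, j} \<subseteq> {..<k}" "\<not> (\<exists>u v. {i, j} = {u, v} \<and> u < k)"
      using j \<open>k \<le> i\<close> by (auto simp: doubleton_eq_iff)
    with j obtain e where e: "e \<in> edges H" "{i, j} = (+) k ` e"
      unfolding edges_join_complete by blast
    have "{i, j} = (+) k ` {i - k, j - k}"
      using j \<open>k \<le> i\<close> by simp
    with e(2) have "e = {i - k, j - k}"
      by (metis inj_image_eq_iff inj_on_add)
    with e(1) j show "j \<in> (+) k ` {j. {i - k, j} \<in> edges H}"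
      by (intro image_eqI[of _ _ "j - k"]) auto
  qed
  then have "card {j \<in> {k..<n}. {i, j} \<in> edges (join_graph (complete_graph k) H)}
      \<le> card {j. {i - k, j} \<in> edges H}"
    using few(2) surj_card_le by blast
  with few(1) show "card {j \<in> {k..<n}. {i, j} \<in> edges (join_graph (complete_graph k) H)} \<le> 1"
    by (meson order_trans)
qed

lemma verts_empty_graph [simp]: "verts (complement_graph (complete_graph m)) = {..<m}"
  and edges_empty_graph [simp]: "edges (complement_graph (complete_graph m)) = {}"
  by (simp_all add: complement_graph_def complete_graph_def)

lemma edges_complete_graph_2: "edges (complete_graph 2) = {{0, 1}}"
proof -
  have "e = {0, 1}" if "e \<subseteq> {..<2}" "card e = 2" for e :: "nat set"
    using card_subset_eq[of "{..<2}" e] that by (auto simp: lessThan_nat_numeral lessThan_Suc)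
  moreover have "{0, 1} \<subseteq> {..<2 :: nat}" by auto
  ultimately show ?thesis
    by (auto simp: complete_graph_def)
qed

lemma near_clique_join_empty:
  assumes "graph_on n (join_graph (complete_graph k) (complement_graph (complete_graph (n - k))))"
    and "k \<le> n"
  shows "near_clique_join k n (join_graph (complete_graph k) (complement_graph (complete_graph (n - k))))"
  using assms by (intro near_clique_join_join_graph[where m = "n - k"]) auto

lemma near_clique_join_single_edge:
  assumes "graph_on n (join_graph (complete_graph k)
      (disjoint_union_graph (complement_graph (complete_graph (n - k - 2))) (complete_graph 2)))"
    and "k + 2 \<le> n"
  shows "near_clique_join k n (join_graph (complete_graph k)
      (disjoint_union_graph (complement_graph (complete_graph (n - k - 2))) (complete_graph 2)))"
proof (rule near_clique_join_join_graph[where m = "n - k", OF assms(1)])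
  let ?m = "n - k - 2"
  let ?H = "disjoint_union_graph (complement_graph (complete_graph ?m)) (complete_graph 2)"
  have "verts ?H = {..<?m} \<union> {?m..<?m + 2}"
    by (simp add: disjoint_union_graph_def shift_graph_def Let_def complete_graph_def
        complement_graph_def lessThan_atLeast0)
  also have "\<dots> = {..<n - k}"
    using assms(2) by auto
  finally show "verts ?H = {..<n - k}" .
  have "edges ?H = {{?m, ?m + 1}}"
    by (simp add: disjoint_union_graph_def shift_graph_def Let_def edges_complete_graph_2)
  then have sub: "{j. {i, j} \<in> edges ?H} \<subseteq> {if i = ?m then ?m + 1 else ?m}" for i
    by (auto simp: doubleton_eq_iff)
  show "card {j. {i, j} \<in> edges ?H} \<le> 1" for i
    using card_mono[OF _ sub[of i]] by simp
  show "finite {j. {i, j} \<in> edges ?H}" for i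
    using finite_subset[OF sub[of i]] by simp
qed (use assms in simp)

section \<open>The extremal problem for squared degrees\<close>

lemma asymptotics_of_bounds:
  fixes f :: "nat \<Rightarrow> real"
  assumes "k \<ge> 1"
    and lower: "\<forall>\<^sub>F n in sequentially. real k * (real n - 1)\<^sup>2 \<le> f n"
    and upper: "\<forall>\<^sub>F n in sequentially. f n \<le> real n * (sqrt (real k * real n) + real k)\<^sup>2"
  shows "\<exists>\<epsilon> :: nat \<Rightarrow> real. \<epsilon> \<in> o(\<lambda>_. 1) \<and>
    (\<forall>\<^sub>F n in sequentially. f n = real k * (real n)\<^sup>2 * (1 + \<epsilon> n))"
proof (intro exI conjI)
  let ?\<epsilon> = "\<lambda>n. f n / (real k * (real n)\<^sup>2) - 1"
  have k: "real k > 0" using \<open>k \<ge> 1\<close> by simp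
  have "?\<epsilon> \<longlonglongrightarrow> 0"
  proof (rule tendsto_sandwich)
    show "\<forall>\<^sub>F n in sequentially.
        real k * (real n - 1)\<^sup>2 / (real k * (real n)\<^sup>2) - 1 \<le> ?\<epsilon> n"
      using lower by eventually_elim (intro diff_right_mono divide_right_mono, auto)
    show "\<forall>\<^sub>F n in sequentially. ?\<epsilon> n \<le>
        real n * (sqrt (real k * real n) + real k)\<^sup>2 / (real k * (real n)\<^sup>2) - 1"
      using upper by eventually_elim (intro diff_right_mono divide_right_mono, auto)
    show "(\<lambda>n. real k * (real n - 1)\<^sup>2 / (real k * (real n)\<^sup>2) - 1) \<longlonglongrightarrow> 0"
      using k by real_asymp
    \<comment> \<open>With \<open>c\<close> in place of \<open>sqrt k\<close> all coefficients are polynomials in one parameter.\<close>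
    define c where "c = sqrt (real k)"
    have "c > 0" "real k = c\<^sup>2" "sqrt (real k * real n) = c * sqrt (real n)" for n
      using k by (simp_all add: c_def real_sqrt_mult)
    moreover have "(\<lambda>n. real n * (c * sqrt (real n) + c\<^sup>2)\<^sup>2 / (c\<^sup>2 * (real n)\<^sup>2) - 1) \<longlonglongrightarrow> 0"
      if "c > 0" using that by real_asymp
    ultimately show "(\<lambda>n. real n * (sqrt (real k * real n) + real k)\<^sup>2 / (real k * (real n)\<^sup>2) - 1) \<longlonglongrightarrow> 0"
      by simp
  qed
  then show "?\<epsilon> \<in> o(\<lambda>_. 1)"
    by (intro smalloI_tendsto) auto
  show "\<forall>\<^sub>F n in sequentially. f n = real k * (real n)\<^sup>2 * (1 + ?\<epsilon> n)"
    using eventually_gt_at_top[of 0] by eventually_elim (use k in simp)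
qed

theorem theorem1p7:
  fixes k :: nat and \<F> :: "'a graph set"
  assumes "k \<ge> 1"
    and "\<And>H. H \<in> \<F> \<Longrightarrow> simple_graph H"
  shows "((\<forall>\<^sub>F n in sequentially. spectral_extremal n \<F> (complete_bipartite_graph k (n - k))) \<longrightarrow>
          (\<forall>\<^sub>F n in sequentially. co2 (complete_bipartite_graph k (n - k)) = exco2 n \<F>)) \<and>
         ((\<forall>\<^sub>F n in sequentially.
             spectral_extremal n \<F>
               (join_graph (complete_graph k) (complement_graph (complete_graph (n - k)))) \<or>
             spectral_extremal n \<F>
               (join_graph (complete_graph k)
                 (disjoint_union_graph (complement_graph (complete_graph (n - k - 2)))
                   (complete_graph 2)))) \<longrightarrow>
          (\<exists>\<epsilon> :: nat \<Rightarrow> real. \<epsilon> \<in> o(\<lambda>_. 1) \<and>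
             (\<forall>\<^sub>F n in sequentially.
                real (exco2 n \<F>) = real k * (real n)\<^sup>2 * (1 + \<epsilon> n))))"
proof (intro conjI impI)
  assume "\<forall>\<^sub>F n in sequentially. spectral_extremal n \<F> (complete_bipartite_graph k (n - k))"
  with eventually_gt_at_top[of k]
  show "\<forall>\<^sub>F n in sequentially. co2 (complete_bipartite_graph k (n - k)) = exco2 n \<F>"
  proof eventually_elim
    case (elim n)
    let ?K = "complete_bipartite_graph k (n - k)"
    have on: "graph_on n ?K"
      using graph_on_complete_bipartite[of k "n - k"] elim by simp
    have "real (exco2 n \<F>) \<le> n * (graph_spectral_radius ?K)\<^sup>2"
      using exco2_le_spectral[OF elim(2)] elim by simp
    also have "\<dots> \<le> n * (sqrt (k * (n - k)))\<^sup>2"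
      using spectral_radius_complete_bipartite_le[of k "n - k"] spectral_radius_nonneg[OF on]
        elim assms(1)
      by (intro mult_left_mono power_mono) auto
    also have "\<dots> = real (n * (k * (n - k)))"
      by simp
    also have "n * (k * (n - k)) = co2 ?K"
      using co2_complete_bipartite[of k "n - k"] elim by simp
    finally have "exco2 n \<F> \<le> co2 ?K"
      by simp
    moreover have "co2 ?K \<le> exco2 n \<F>"
      using elim(2) by (intro co2_le_exco2) (simp add: spectral_extremal_def)
    ultimately show ?case by simp
  qed
next
  assume ext: "\<forall>\<^sub>F n in sequentially.
     spectral_extremal n \<F>
       (join_graph (complete_graph k) (complement_graph (complete_graph (n - k)))) \<or>
     spectral_extremal n \<F>
       (join_graph (complete_graph k)
         (disjoint_union_graph (complement_graph (complete_graph (n - k - 2)))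
           (complete_graph 2)))"
  have "\<forall>\<^sub>F n in sequentially. \<exists>G. spectral_extremal n \<F> G \<and> near_clique_join k n G"
    using ext eventually_ge_at_top[of "k + 2"]
  proof eventually_elim
    case (elim n)
    have "graph_on n G" if "spectral_extremal n \<F> G" for G
      using that by (simp add: spectral_extremal_def free_graphs_def)
    with elim near_clique_join_empty[of n k] near_clique_join_single_edge[of n k]
    show ?case by (metis add_leD1)
  qed
  with eventually_ge_at_top[of k]
  have bounds: "\<forall>\<^sub>F n in sequentially. real k * (real n - 1)\<^sup>2 \<le> exco2 n \<F> \<and>
      exco2 n \<F> \<le> real n * (sqrt (real k * real n) + real k)\<^sup>2"
  proof eventually_elim
    case (elim n)
    then obtain G where G: "spectral_extremal n \<F> G" "near_clique_join k n G" by blast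
    have on: "graph_on n G" and free: "G \<in> free_graphs n \<F>"
      using G by (simp_all add: spectral_extremal_def near_clique_join_def)
    have "n > 0" using elim assms(1) by simp
    have "k * (n - 1)\<^sup>2 \<le> exco2 n \<F>"
      using co2_near_clique_join_ge[OF G(2) elim(1)] co2_le_exco2[OF free] by simp
    then have "real (k * (n - 1)\<^sup>2) \<le> exco2 n \<F>"
      by (simp only: of_nat_le_iff)
    then have "real k * (real n - 1)\<^sup>2 \<le> exco2 n \<F>"
      using \<open>n > 0\<close> by simp
    moreover have "real (exco2 n \<F>) \<le> n * (graph_spectral_radius G)\<^sup>2"
      using exco2_le_spectral[OF G(1) \<open>n > 0\<close>] .
    moreover have "n * (graph_spectral_radius G)\<^sup>2 \<le> real n * (sqrt (real k * real n) + real k)\<^sup>2"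
      using spectral_radius_near_clique_join_le[OF G(2) assms(1) elim(1)]
        spectral_radius_nonneg[OF on \<open>n > 0\<close>]
      by (intro mult_left_mono power_mono) auto
    ultimately show ?case by linarith
  qed
  show "\<exists>\<epsilon> :: nat \<Rightarrow> real. \<epsilon> \<in> o(\<lambda>_. 1) \<and>
      (\<forall>\<^sub>F n in sequentially. real (exco2 n \<F>) = real k * (real n)\<^sup>2 * (1 + \<epsilon> n))"
    by (rule asymptotics_of_bounds[OF assms(1)]) (use bounds in eventually_elim, simp)+
qed

end
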